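(* Let $p,q,s$ be real numbers, put $r=p-s$, and let $D_n$ be the $n\times n$ symmetric pentadiagonal matrix with perturbed corners determined by $p,q,r,s$. Then: 1. $D_n$ has a null eigenvalue if and only if $$4s\cos^2\left(\frac{k\pi}{n+1}\right)+2q\cos\left(\frac{k\pi}{n+1}\right)+p-2s=0$$ for some $k$ such that $1\le k\le n$. 2. A closed expression for the determinant of $D_n$ is $$\det(D_n)=\prod_{k=1}^n\left(4s\cos^2\left(\frac{k\pi}{n+1}\right)+2q\cos\left(\frac{k\pi}{n+1}\right)+p-2s\right).$$ 3. Let $$\mathcal D_0=\bigcup_{n\in\mathbb N}\left\{(p,q,s)\ :\ 0<s,\ p=2s\left(1+2\cos^2\left(\tfrac{k\pi}{n+1}\right)\right),\ q=-4s\cos\left(\tfrac{k\pi}{n+1}\right),\text{ for } k\in\mathbb N\right\}.$$ If $(p,q,s)\in(\mathcal D_1\cup\mathcal D_2\cup\mathcal D_3\cup\mathcal D_4)\setminus\mathcal D_0$, then $D_n$ is positive definite for all $n\in\mathbb N$.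
   Context: For real $p,q,r,s$, $D_n=[d_{ij}]_{1\le i,j\le n}$ is the real symmetric $n\times n$ matrix with $d_{11}=d_{nn}=r$, $d_{ii}=p$ for $2\le i\le n-1$, $d_{ij}=q$ if $|i-j|=1$, $d_{ij}=s$ if $|i-j|=2$, and $d_{ij}=0$ if $|i-j|\ge 3$. A real symmetric matrix is positive definite if all its eigenvalues are positive. The sets of triples $(p,q,s)$ are $$\mathcal D_1=\left\{-\tfrac p2\le s<0,\ -\tfrac12(p+2s)\le q\le \tfrac12(p+2s)\right\},$$ $$\mathcal D_2=\left\{s=0,\ p\ge 2|q|\right\},$$ $$\mathcal D_3=\left\{0<s\le \tfrac p2,\ -\sqrt{4s(p-2s)}\le q\le \sqrt{4s(p-2s)}\right\},$$ $$\mathcal D_4=\left\{0<s<\tfrac p6,\ \left(-\tfrac12(p+2s)\le q<-\sqrt{4s(p-2s)}\ \text{ or }\ \sqrt{4s(p-2s)}<q\le \tfrac12(p+2s)\right)\right\}.$$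
   Formalization: Items 1 and 2 are stated for n≥2, or n=1 with s=0 (for n=1, p=2, s=1 the determinant is p−s=1 but the product is p−2s=0); item 3 excludes (p,q,s)=(0,0,0), which lies in D_2 and not in D_0 but gives the zero matrix. *)

theory Defs
  imports "Jordan_Normal_Form.Char_Poly"
begin

text \<open>The entry formula uses the 1-based indices \<open>1 \<le> i, j \<le> n\<close>; matrices of the library are
  indexed from 0, hence the shift by \<open>Suc\<close> in the second definition.\<close>

definition penta_entry ::
  "real \<Rightarrow> real \<Rightarrow> real \<Rightarrow> real \<Rightarrow> nat \<Rightarrow> nat \<Rightarrow> nat \<Rightarrow> real" where
  "penta_entry p q r s n i j =
     (if i = j then (if i = 1 \<or> i = n then r else p)
      else if \<bar>int i - int j\<bar> = 1 then q
      else if \<bar>int i - int j\<bar> = 2 then s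
      else 0)"

definition penta_mat :: "real \<Rightarrow> real \<Rightarrow> real \<Rightarrow> real \<Rightarrow> nat \<Rightarrow> real mat" where
  "penta_mat p q r s n = mat n n (\<lambda>(i, j). penta_entry p q r s n (Suc i) (Suc j))"

text \<open>Only real eigenvalues are mentioned; a real symmetric matrix has no others.\<close>

definition positive_definite :: "real mat \<Rightarrow> bool" where
  "positive_definite A \<longleftrightarrow>
     square_mat A \<and> transpose_mat A = A \<and> (\<forall>x. eigenvalue A x \<longrightarrow> 0 < x)"

definition region_D1 :: "(real \<times> real \<times> real) set" where
  "region_D1 = {(p, q, s). - p / 2 \<le> s \<and> s < 0 \<and>
     - (1/2) * (p + 2 * s) \<le> q \<and> q \<le> (1/2) * (p + 2 * s)}"

definition region_D2 :: "(real \<times> real \<times> real) set" where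
  "region_D2 = {(p, q, s). s = 0 \<and> p \<ge> 2 * \<bar>q\<bar>}"

definition region_D3 :: "(real \<times> real \<times> real) set" where
  "region_D3 = {(p, q, s). 0 < s \<and> s \<le> p / 2 \<and>
     - sqrt (4 * s * (p - 2 * s)) \<le> q \<and> q \<le> sqrt (4 * s * (p - 2 * s))}"

definition region_D4 :: "(real \<times> real \<times> real) set" where
  "region_D4 = {(p, q, s). 0 < s \<and> s < p / 6 \<and>
     ((- (1/2) * (p + 2 * s) \<le> q \<and> q < - sqrt (4 * s * (p - 2 * s))) \<or>
      (sqrt (4 * s * (p - 2 * s)) < q \<and> q \<le> (1/2) * (p + 2 * s)))}"

text \<open>\<open>k\<close> is deliberately not bounded by \<open>n\<close>. Here \<open>n\<close> and \<open>k\<close> range over the positive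
  integers; admitting 0 would give the same set, since \<open>cos\<close> then only takes the values
  \<open>1\<close> and \<open>-1\<close>, which already occur for \<open>k = 2 * (n + 1)\<close> and \<open>k = n + 1\<close>.\<close>

definition region_D0 :: "(real \<times> real \<times> real) set" where
  "region_D0 = (\<Union>n\<in>{1::nat..}. {(p, q, s). 0 < s \<and>
     (\<exists>k::nat. 1 \<le> k \<and>
        p = 2 * s * (1 + 2 * (cos (real k * pi / (real n + 1)))\<^sup>2) \<and>
        q = - 4 * s * cos (real k * pi / (real n + 1)))})"

end

theory Submission
  imports Defs
begin

text \<open>
  With \<open>r = p - s\<close> the matrix is a polynomial in the adjacency matrix \<open>T\<close> of the path on \<open>n\<close>
  vertices, namely \<open>s T\<^sup>2 + q T + (p - 2 s) I\<close>: the diagonal of \<open>T\<^sup>2\<close> counts neighbours, so it is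
  \<open>2\<close> except at the two end vertices, where it is \<open>1\<close>; this is exactly the corner perturbation
  (\<open>penta_mat_eq_path_mat_poly\<close>). The discrete sine matrix \<open>S\<close> diagonalizes \<open>T\<close> with eigenvalues
  \<open>2 cos (k \<pi> / (n + 1))\<close> (\<open>path_mat_mult_sine_mat\<close>), and it is invertible because these eigenvalues
  are distinct and \<open>T\<close> is symmetric (\<open>det_sine_mat_nonzero\<close>). So the pentadiagonal matrix is
  diagonalized by \<open>S\<close> too, and its eigenvalues are the values of
  \<open>4 s c\<^sup>2 + 2 q c + p - 2 s\<close> at the nodes \<open>c = cos (k \<pi> / (n + 1))\<close>. This gives the
  determinant; the spectrum follows from the determinant alone, since subtracting \<open>x I\<close> only
  replaces \<open>p\<close> by \<open>p - x\<close> and preserves the relation \<open>r = p - s\<close>.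

  For positive definiteness, each triple in the four regions makes this quadratic in \<open>c\<close>
  nonnegative on \<open>[-1, 1]\<close>. All nodes lie in the open interval, where the quadratic of a nonzero
  triple can vanish only at a double root with \<open>s > 0\<close>, and every triple that has its double root
  at a node is in the excluded set (\<open>symbol_pos\<close>). The order \<open>n = 1\<close> with \<open>s \<noteq> 0\<close> stands
  apart: the two corners coincide, so the single entry is \<open>p - s\<close>, whereas the polynomial in
  \<open>T = 0\<close> is \<open>p - 2 s\<close>.
\<close>

section \<open>A polynomial in the adjacency matrix of a path\<close>

definition angle :: "nat \<Rightarrow> nat \<Rightarrow> real" where
  "angle n k = real k * pi / (real n + 1)"

text \<open>The polynomial \<open>s x\<^sup>2 + q x + p - 2 s\<close> at \<open>x = 2 c\<close>, in the form that suits the eigenvalues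
  \<open>2 cos (k \<pi> / (n + 1))\<close> of the path.\<close>

definition symbol :: "real \<Rightarrow> real \<Rightarrow> real \<Rightarrow> real \<Rightarrow> real" where
  "symbol p q s c = 4 * s * c\<^sup>2 + 2 * q * c + p - 2 * s"

definition path_mat :: "nat \<Rightarrow> real mat" where
  "path_mat n = mat n n (\<lambda>(i, j). if j = Suc i \<or> i = Suc j then 1 else 0)"

definition sine_mat :: "nat \<Rightarrow> real mat" where
  "sine_mat n = mat n n (\<lambda>(i, j). sin (real (Suc i) * angle n (Suc j)))"

lemma path_mat_carrier [simp]: "path_mat n \<in> carrier_mat n n"
  and sine_mat_carrier [simp]: "sine_mat n \<in> carrier_mat n n"
  and penta_mat_carrier [simp]: "penta_mat p q r s n \<in> carrier_mat n n"
  by (simp_all add: path_mat_def sine_mat_def penta_mat_def)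

lemma transpose_path_mat: "transpose_mat (path_mat n) = path_mat n"
  by (rule eq_matI) (auto simp: path_mat_def)

lemma transpose_sine_mat: "transpose_mat (sine_mat n) = sine_mat n"
  by (rule eq_matI) (simp_all add: sine_mat_def angle_def mult_ac)

lemma transpose_penta_mat: "transpose_mat (penta_mat p q r s n) = penta_mat p q r s n"
  by (rule eq_matI) (auto simp: penta_mat_def penta_entry_def)

text \<open>A row of \<open>T\<close> has at most two nonzero entries, so a product with \<open>T\<close> is a sum of two
  neighbouring rows. This rule computes both \<open>T\<^sup>2\<close> and the action of \<open>T\<close> on the sine matrix.\<close>

lemma path_mat_mult_index:
  assumes A: "A \<in> carrier_mat n m" and ij: "i < n" "j < m"
  shows "(path_mat n * A) $$ (i, j) =
    (if Suc i < n then A $$ (Suc i, j) else 0) + (if i = 0 then 0 else A $$ (i - 1, j))"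
proof -
  have "(path_mat n * A) $$ (i, j) =
      (\<Sum>k\<in>{0..<n}. (if k = Suc i \<or> i = Suc k then 1 else 0) * A $$ (k, j))"
    using assms by (auto simp: path_mat_def scalar_prod_def intro!: sum.cong)
  also have "\<dots> = (\<Sum>k\<in>{0..<n}. (if k = Suc i then A $$ (k, j) else 0)
      + (if k = i - 1 then (if i = 0 then 0 else A $$ (k, j)) else 0))"
    by (rule sum.cong) auto
  also have "\<dots> = (if Suc i < n then A $$ (Suc i, j) else 0)
      + (if i = 0 then 0 else A $$ (i - 1, j))"
    unfolding sum.distrib using ij by (auto simp: sum.delta)
  finally show ?thesis .
qed

lemma penta_mat_index:
  assumes "i < n" "j < n"
  shows "penta_mat p q r s n $$ (i, j) =
    (if i = j then (if i = 0 \<or> Suc i = n then r else p)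
     else if j = Suc i \<or> i = Suc j then q
     else if j = Suc (Suc i) \<or> i = Suc (Suc j) then s else 0)"
proof -
  have "\<bar>int (Suc i) - int (Suc j)\<bar> = 1 \<longleftrightarrow> j = Suc i \<or> i = Suc j"
    and "\<bar>int (Suc i) - int (Suc j)\<bar> = 2 \<longleftrightarrow> j = Suc (Suc i) \<or> i = Suc (Suc j)"
    by linarith+
  then show ?thesis using assms by (simp add: penta_mat_def penta_entry_def)
qed

text \<open>Two steps along the path lead from \<open>i\<close> to \<open>i \<plusminus> 2\<close> in one way and back to \<open>i\<close> in as many ways as
  \<open>i\<close> has neighbours. At an end vertex of a path with \<open>n \<ge> 2\<close> the diagonal entry is therefore
  \<open>s + (p - 2 s) = p - s\<close>; the single vertex for \<open>n = 1\<close> has no neighbour, which forces \<open>s = 0\<close>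
  there.\<close>

lemma penta_mat_eq_path_mat_poly:
  assumes "n \<noteq> 1 \<or> s = 0"
  shows "penta_mat p q (p - s) s n =
    s \<cdot>\<^sub>m (path_mat n * path_mat n) + q \<cdot>\<^sub>m path_mat n + (p - 2 * s) \<cdot>\<^sub>m 1\<^sub>m n"
proof (rule eq_matI)
  fix i j
  assume "i < dim_row (s \<cdot>\<^sub>m (path_mat n * path_mat n) + q \<cdot>\<^sub>m path_mat n + (p - 2 * s) \<cdot>\<^sub>m 1\<^sub>m n)"
    and "j < dim_col (s \<cdot>\<^sub>m (path_mat n * path_mat n) + q \<cdot>\<^sub>m path_mat n + (p - 2 * s) \<cdot>\<^sub>m 1\<^sub>m n)"
  then have ij: "i < n" "j < n" by simp_all
  have dims: "dim_row (path_mat n) = n" "dim_col (path_mat n) = n"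
    by (simp_all add: path_mat_def)
  have "(s \<cdot>\<^sub>m (path_mat n * path_mat n) + q \<cdot>\<^sub>m path_mat n + (p - 2 * s) \<cdot>\<^sub>m 1\<^sub>m n) $$ (i, j)
    = s * (path_mat n * path_mat n) $$ (i, j) + q * path_mat n $$ (i, j)
      + (p - 2 * s) * (if i = j then 1 else 0)"
    using ij by (simp add: dims)
  also have "\<dots> = penta_mat p q (p - s) s n $$ (i, j)"
  proof -
    consider "j = i" | "j = Suc i" | "i = Suc j" | "j = Suc (Suc i)" | "i = Suc (Suc j)"
      | "j \<noteq> i" "j \<noteq> Suc i" "i \<noteq> Suc j" "j \<noteq> Suc (Suc i)" "i \<noteq> Suc (Suc j)"
      by blast
    then show ?thesis
      unfolding path_mat_mult_index[OF path_mat_carrier ij] penta_mat_index[OF ij]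
      by cases (use ij assms in \<open>auto simp: path_mat_def\<close>)
  qed
  finally show "penta_mat p q (p - s) s n $$ (i, j) =
    (s \<cdot>\<^sub>m (path_mat n * path_mat n) + q \<cdot>\<^sub>m path_mat n + (p - 2 * s) \<cdot>\<^sub>m 1\<^sub>m n) $$ (i, j)" ..
qed (simp_all add: penta_mat_def path_mat_def)

section \<open>Diagonalization by the discrete sine matrix\<close>

text \<open>The sine vectors vanish at the fictitious vertex \<open>n + 1\<close>, so that the recurrence satisfied in
  the interior of the path continues to hold at its last vertex.\<close>

lemma sin_Suc_angle:
  assumes "Suc i = n"
  shows "sin (real (Suc (Suc i)) * angle n k) = 0"
proof -
  have "real (Suc (Suc i)) * angle n k = real k * pi"
    using assms by (auto simp: angle_def field_simps)
  then show ?thesis by (simp only: sin_npi)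
qed

text \<open>The identity \<open>sin ((i + 1) a) + sin ((i - 1) a) = 2 cos a sin (i a)\<close>, with both boundary terms
  \<open>sin 0\<close> and \<open>sin ((n + 1) a)\<close> equal to zero.\<close>

lemma path_mat_mult_sine_mat:
  "path_mat n * sine_mat n = sine_mat n * mat_diag n (\<lambda>k. 2 * cos (angle n (Suc k)))"
proof (rule eq_matI)
  fix i k
  assume "i < dim_row (sine_mat n * mat_diag n (\<lambda>k. 2 * cos (angle n (Suc k))))"
    and "k < dim_col (sine_mat n * mat_diag n (\<lambda>k. 2 * cos (angle n (Suc k))))"
  then have ik: "i < n" "k < n" by (simp_all add: sine_mat_def mat_diag_def)
  let ?a = "angle n (Suc k)"
  have upper: "(if Suc i < n then sine_mat n $$ (Suc i, k) else 0) = sin (real (Suc (Suc i)) * ?a)"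
  proof (cases "Suc i < n")
    case True
    then show ?thesis using ik by (simp add: sine_mat_def)
  next
    case False
    with ik have "Suc i = n" by simp
    then show ?thesis using sin_Suc_angle[of i n "Suc k"] by simp
  qed
  have lower: "(if i = 0 then 0 else sine_mat n $$ (i - 1, k)) = sin (real i * ?a)"
    using ik by (auto simp: sine_mat_def)
  have "sin (real (Suc (Suc i)) * ?a) + sin (real i * ?a)
      = sin (real (Suc i) * ?a + ?a) + sin (real (Suc i) * ?a - ?a)"
    by (simp add: algebra_simps)
  also have "\<dots> = sin (real (Suc i) * ?a) * (2 * cos ?a)"
    unfolding sin_add sin_diff by (simp add: algebra_simps)
  finally show "(path_mat n * sine_mat n) $$ (i, k)
      = (sine_mat n * mat_diag n (\<lambda>k. 2 * cos (angle n (Suc k)))) $$ (i, k)"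
    unfolding path_mat_mult_index[OF sine_mat_carrier ik] upper lower
      mat_diag_mult_right[OF sine_mat_carrier]
    using ik by (simp add: sine_mat_def)
qed (simp_all add: path_mat_def sine_mat_def mat_diag_def)

lemma angle_bounds:
  assumes "1 \<le> k" "k \<le> n"
  shows "0 < angle n k" "angle n k < pi"
proof -
  have "real k * pi < (real n + 1) * pi" using assms by (intro mult_strict_right_mono) auto
  then show "angle n k < pi" by (simp add: angle_def divide_less_eq mult.commute)
qed (use assms in \<open>simp add: angle_def\<close>)

lemma cos_angle_inj:
  assumes k: "1 \<le> k" "k \<le> n" and l: "1 \<le> l" "l \<le> n"
    and cos_eq: "cos (angle n k) = cos (angle n l)"
  shows "k = l"
proof -
  have "angle n k = angle n l"
    using angle_bounds[OF k] angle_bounds[OF l] by (intro cos_inj_pi[OF _ _ _ _ cos_eq]) auto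
  then show ?thesis by (simp add: angle_def)
qed

text \<open>Eigenvectors of a symmetric matrix for distinct eigenvalues are orthogonal, so the Gram matrix
  of the columns of \<open>S\<close>, which is \<open>S\<^sup>2\<close> because \<open>S\<close> is symmetric, is diagonal. Its
  diagonal entries are squared norms of nonzero vectors.\<close>

lemma det_sine_mat_nonzero: "det (sine_mat n) \<noteq> 0"
proof -
  let ?S = "sine_mat n" and ?T = "path_mat n"
  let ?M = "mat_diag n (\<lambda>k. 2 * cos (angle n (Suc k)))"
  define G where "G = ?S * ?S"
  have G: "G \<in> carrier_mat n n" unfolding G_def by (metis mult_carrier_mat sine_mat_carrier)
  have ST: "?S * ?T = ?M * ?S"
  proof -
    have "transpose_mat (?T * ?S) = transpose_mat (?S * ?M)"
      by (simp only: path_mat_mult_sine_mat)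
    moreover have "transpose_mat ?M = ?M" by (rule eq_matI) (auto simp: mat_diag_def)
    ultimately show ?thesis
      by (simp add: transpose_mult[of _ n n _ n] transpose_path_mat transpose_sine_mat)
  qed
  have "G * ?M = ?S * (?T * ?S)"
    unfolding G_def path_mat_mult_sine_mat by (rule assoc_mult_mat[of _ n n _ n _ n]) simp_all
  also have "\<dots> = (?S * ?T) * ?S" by (rule assoc_mult_mat[of _ n n _ n _ n, symmetric]) simp_all
  also have "\<dots> = ?M * G" unfolding ST G_def by (rule assoc_mult_mat[of _ n n _ n _ n]) simp_all
  finally have comm: "G * ?M = ?M * G" .
  \<comment> \<open>A matrix that commutes with a diagonal matrix with distinct entries is diagonal.\<close>
  have off: "G $$ (i, j) = 0" if "i < n" "j < n" "i \<noteq> j" for i j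
  proof -
    have "(G * ?M) $$ (i, j) = (?M * G) $$ (i, j)" using comm by simp
    then have "G $$ (i, j) * (2 * cos (angle n (Suc j))) = (2 * cos (angle n (Suc i))) * G $$ (i, j)"
      unfolding mat_diag_mult_right[OF G] mat_diag_mult_left[OF G] using that by simp
    moreover have "cos (angle n (Suc i)) \<noteq> cos (angle n (Suc j))"
      using cos_angle_inj[of "Suc i" n "Suc j"] that by auto
    ultimately show ?thesis by auto
  qed
  have diag: "G $$ (i, i) \<noteq> 0" if i: "i < n" for i
  proof -
    have "G $$ (i, i) = (\<Sum>k\<in>{0..<n}. ?S $$ (i, k) * ?S $$ (k, i))"
      unfolding G_def using i by (simp add: sine_mat_def scalar_prod_def)
    also have "\<dots> = (\<Sum>k\<in>{0..<n}. (?S $$ (k, i))\<^sup>2)"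
    proof (rule sum.cong)
      fix k assume "k \<in> {0..<n}"
      then show "?S $$ (i, k) * ?S $$ (k, i) = (?S $$ (k, i))\<^sup>2"
        using i by (simp add: sine_mat_def angle_def power2_eq_square mult_ac)
    qed simp
    also have "\<dots> > 0"
    \<comment> \<open>The first coordinate of a sine vector is the sine of an angle strictly between
      \<open>0\<close> and \<open>\<pi>\<close>.\<close>
    proof (rule sum_pos2[where i = 0])
      have "0 < angle n (Suc i)" "angle n (Suc i) < pi"
        using i angle_bounds[of "Suc i" n] by auto
      then have "sin (angle n (Suc i)) > 0" by (rule sin_gt_zero)
      then show "0 < (?S $$ (0, i))\<^sup>2" using i by (simp add: sine_mat_def)
    qed (use i in auto)
    finally show ?thesis by simp
  qed
  have "det G = prod_list (diag_mat G)"
    using off G by (intro det_upper_triangular[of _ n] upper_triangularI) auto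
  also have "\<dots> \<noteq> 0"
    using diag G by (auto simp: prod_list_zero_iff diag_mat_def)
  finally show ?thesis
    unfolding G_def by (auto simp: det_mult[of _ n])
qed

lemma penta_mat_mult_sine_mat:
  assumes "n \<noteq> 1 \<or> s = 0"
  shows "penta_mat p q (p - s) s n * sine_mat n
    = sine_mat n * mat_diag n (\<lambda>k. symbol p q s (cos (angle n (Suc k))))"
proof -
  let ?S = "sine_mat n" and ?T = "path_mat n" and ?c = "\<lambda>k. cos (angle n (Suc k))"
  let ?M = "mat_diag n (\<lambda>k. 2 * ?c k)"
  have TT: "?T * ?T \<in> carrier_mat n n" by (rule mult_carrier_mat[of _ n n]) simp_all
  have "(?T * ?T) * ?S = ?T * (?T * ?S)" by (rule assoc_mult_mat[of _ n n _ n _ n]) simp_all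
  also have "\<dots> = (?T * ?S) * ?M"
    unfolding path_mat_mult_sine_mat
    by (subst (1) path_mat_mult_sine_mat[symmetric])
      (rule assoc_mult_mat[of _ n n _ n _ n, symmetric], simp_all)
  also have "\<dots> = ?S * (?M * ?M)"
    unfolding path_mat_mult_sine_mat by (rule assoc_mult_mat[of _ n n _ n _ n]) simp_all
  finally have TTS: "(?T * ?T) * ?S = ?S * mat_diag n (\<lambda>k. 2 * ?c k * (2 * ?c k))"
    by (simp add: mat_diag_diag)
  show ?thesis
  proof (rule eq_matI)
    fix i k
    assume "i < dim_row (?S * mat_diag n (\<lambda>k. symbol p q s (?c k)))"
      and "k < dim_col (?S * mat_diag n (\<lambda>k. symbol p q s (?c k)))"
    then have ik: "i < n" "k < n" by (simp_all add: sine_mat_def mat_diag_def)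
    have "penta_mat p q (p - s) s n * ?S
        = s \<cdot>\<^sub>m ((?T * ?T) * ?S) + q \<cdot>\<^sub>m (?T * ?S) + (p - 2 * s) \<cdot>\<^sub>m ?S"
      unfolding penta_mat_eq_path_mat_poly[OF assms]
      using TT by (simp add: add_mult_distrib_mat[of _ n n _ _ n] mult_smult_assoc_mat[of _ n n _ n]
          left_mult_one_mat[of _ n n])
    then show "(penta_mat p q (p - s) s n * ?S) $$ (i, k)
        = (?S * mat_diag n (\<lambda>k. symbol p q s (?c k))) $$ (i, k)"
      unfolding TTS path_mat_mult_sine_mat
      using ik
      by (simp add: mat_diag_mult_right[of _ n n] sine_mat_def symbol_def algebra_simps
          power2_eq_square)
  qed (simp_all add: penta_mat_def sine_mat_def mat_diag_def)
qed

section \<open>Determinant and spectrum\<close>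

lemma det_penta_mat:
  assumes "n \<noteq> 1 \<or> s = 0"
  shows "det (penta_mat p q (p - s) s n) = (\<Prod>k = 1..n. symbol p q s (cos (angle n k)))"
proof -
  let ?L = "mat_diag n (\<lambda>k. symbol p q s (cos (angle n (Suc k))))"
  have "det (penta_mat p q (p - s) s n) * det (sine_mat n) = det (sine_mat n) * det ?L"
    using arg_cong[OF penta_mat_mult_sine_mat[OF assms, of p q], of det]
    unfolding det_mult[OF penta_mat_carrier sine_mat_carrier]
      det_mult[OF sine_mat_carrier mat_diag_dim] .
  then have "det (penta_mat p q (p - s) s n) = det ?L"
    using det_sine_mat_nonzero by simp
  also have "\<dots> = prod_list (diag_mat ?L)"
    by (intro det_upper_triangular[of _ n] upper_triangularI) (auto simp: mat_diag_def)
  also have "\<dots> = (\<Prod>k = 0..<n. symbol p q s (cos (angle n (Suc k))))"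
    by (simp add: prod_list_diag_prod mat_diag_def)
  also have "\<dots> = (\<Prod>k = 1..n. symbol p q s (cos (angle n k)))"
    by (rule prod.reindex_bij_witness[of _ "\<lambda>k. k - 1" Suc]) auto
  finally show ?thesis .
qed

text \<open>The family is closed under subtracting multiples of the identity, so the determinant formula
  for the parameter \<open>p - x\<close> is, up to sign, the characteristic polynomial for the parameter \<open>p\<close>.\<close>

lemma eigenvalue_penta_mat_iff:
  assumes "n \<noteq> 1 \<or> s = 0"
  shows "eigenvalue (penta_mat p q (p - s) s n) x \<longleftrightarrow>
    (\<exists>k. 1 \<le> k \<and> k \<le> n \<and> symbol p q s (cos (angle n k)) = x)"
proof -
  have "char_matrix (penta_mat p q (p - s) s n) x = penta_mat (p - x) q (p - x - s) s n"
    by (rule eq_matI) (auto simp: char_matrix_def penta_mat_def penta_entry_def)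
  then have "eigenvalue (penta_mat p q (p - s) s n) x
      \<longleftrightarrow> (\<Prod>k = 1..n. symbol (p - x) q s (cos (angle n k))) = 0"
    by (simp add: eigenvalue_det[of _ n] det_penta_mat[OF assms])
  also have "\<dots> \<longleftrightarrow> (\<exists>k. 1 \<le> k \<and> k \<le> n \<and> symbol p q s (cos (angle n k)) = x)"
  proof -
    have "symbol (p - x) q s c = symbol p q s c - x" for c by (simp add: symbol_def)
    then show ?thesis by (auto simp: prod_zero_iff)
  qed
  finally show ?thesis .
qed

section \<open>Positivity\<close>

text \<open>If \<open>s < 0\<close>, the quadratic is strictly concave and nonnegative at \<open>\<plusminus>1\<close>, hence positive in
  between. If \<open>s = 0\<close>, it is affine, not identically zero and nonnegative at \<open>\<plusminus>1\<close>. In the third region it is convex with discriminant at most \<open>0\<close>, so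
  it could vanish only at a double root, and \<open>c\<close> is assumed not to be one. In the fourth
  region it has two real roots, but its vertex \<open>- q / (4 s)\<close> lies outside \<open>[-1, 1]\<close>, so inside the
  interval it exceeds its value at the end point nearer to the vertex, which is nonnegative.\<close>

lemma symbol_pos:
  assumes reg: "(p, q, s) \<in> region_D1 \<union> region_D2 \<union> region_D3 \<union> region_D4"
    and nz: "(p, q, s) \<noteq> (0, 0, 0)"
    and c: "-1 < c" "c < 1"
    and exc: "\<not> (0 < s \<and> p = 2 * s * (1 + 2 * c\<^sup>2) \<and> q = - 4 * s * c)"
  shows "0 < symbol p q s c"
proof -
  have c2: "c\<^sup>2 < 1" using c by (simp add: abs_square_less_1 abs_less_iff)
  \<comment> \<open>The chord through the values at \<open>\<plusminus>1\<close>, and what the quadratic has above it.\<close>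
  have convex_comb: "2 * symbol p q s c =
      (1 + c) * (p + 2 * s + 2 * q) + (1 - c) * (p + 2 * s - 2 * q) - 8 * s * (1 - c\<^sup>2)"
    by (simp add: symbol_def algebra_simps power2_eq_square)
  have square: "4 * s * symbol p q s c = (4 * s * c + q)\<^sup>2 + (4 * s * (p - 2 * s) - q\<^sup>2)"
    by (simp add: symbol_def algebra_simps power2_eq_square)
  from reg consider (D1) "(p, q, s) \<in> region_D1" | (D2) "(p, q, s) \<in> region_D2"
    | (D3) "(p, q, s) \<in> region_D3" | (D4) "(p, q, s) \<in> region_D4"
    by blast
  then show ?thesis
  proof cases
    case D1
    then have s: "s < 0" and ends: "0 \<le> p + 2 * s + 2 * q" "0 \<le> p + 2 * s - 2 * q"
      by (auto simp: region_D1_def field_simps)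
    have "0 \<le> (1 + c) * (p + 2 * s + 2 * q)" "0 \<le> (1 - c) * (p + 2 * s - 2 * q)"
      using ends c by auto
    moreover have "s * (1 - c\<^sup>2) < 0" using s c2 by (simp add: mult_neg_pos)
    ultimately show ?thesis using convex_comb by linarith
  next
    case D2
    then have s: "s = 0" and pq: "2 * \<bar>q\<bar> \<le> p" by (auto simp: region_D2_def)
    show ?thesis
    proof (cases "q = 0")
      case True
      then show ?thesis using s pq nz by (simp add: symbol_def)
    next
      case False
      have "\<bar>q * c\<bar> < \<bar>q\<bar>" using False c by (simp add: abs_mult abs_less_iff)
      then have "0 < 2 * (q * c) + p" using pq by linarith
      then show ?thesis using s by (simp add: symbol_def mult.assoc)
    qed
  next
    case D3
    then have s: "0 < s" and q: "\<bar>q\<bar> \<le> sqrt (4 * s * (p - 2 * s))" and ps: "s \<le> p / 2"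
      by (auto simp: region_D3_def)
    have "0 \<le> 4 * s * (p - 2 * s)" using s ps by simp
    then have disc: "q\<^sup>2 \<le> 4 * s * (p - 2 * s)"
      using power_mono[OF q, of 2] by simp
    have "0 \<noteq> 4 * s * symbol p q s c"
    proof
      assume "0 = 4 * s * symbol p q s c"
      with square disc have "(4 * s * c + q)\<^sup>2 = 0" and eq: "q\<^sup>2 = 4 * s * (p - 2 * s)"
        using zero_le_power2[of "4 * s * c + q"] by linarith+
      then have q: "q = - 4 * s * c" by simp
      with eq have "4 * s * (4 * s * c\<^sup>2) = 4 * s * (p - 2 * s)"
        by (simp add: power2_eq_square algebra_simps)
      then have "4 * s * c\<^sup>2 = p - 2 * s" using s by simp
      then have "p = 2 * s * (1 + 2 * c\<^sup>2)" by (simp add: algebra_simps)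
      with exc s q show False by simp
    qed
    moreover have "0 \<le> 4 * s * symbol p q s c" using square disc by simp
    ultimately have "0 < 4 * s * symbol p q s c" by linarith
    then show ?thesis using s by (simp add: zero_less_mult_iff)
  next
    case D4
    then have s: "0 < s" "6 * s < p"
      by (auto simp: region_D4_def)
    define R where "R = sqrt (4 * s * (p - 2 * s))"
    have R_nonneg: "0 \<le> R" using s by (simp add: R_def)
    from D4 consider "- ((p + 2 * s) / 2) \<le> q" "q < - R" | "R < q" "q \<le> (p + 2 * s) / 2"
      by (auto simp: region_D4_def R_def)
    then have "R < \<bar>q\<bar> \<and> 2 * \<bar>q\<bar> \<le> p + 2 * s"
    proof cases
      case 1
      then have "\<bar>q\<bar> = - q" using R_nonneg by simp
      with 1 show ?thesis by (simp add: field_simps)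
    next
      case 2
      then have "\<bar>q\<bar> = q" using R_nonneg by simp
      with 2 show ?thesis by (simp add: field_simps)
    qed
    then have q: "R < \<bar>q\<bar>" and ends: "2 * \<bar>q\<bar> \<le> p + 2 * s" by auto
    \<comment> \<open>\<open>6 s < p\<close> means \<open>4 s < p - 2 s\<close>, so \<open>q\<^sup>2 > 4 s (p - 2 s)\<close> gives \<open>\<bar>q\<bar> > 4 s\<close>: the
      vertex is outside \<open>[-1, 1]\<close>.\<close>
    have "(4 * s)\<^sup>2 \<le> 4 * s * (p - 2 * s)"
      using s by (simp add: power2_eq_square)
    then have "4 * s \<le> R" unfolding R_def by (rule real_le_rsqrt)
    with q have q4: "4 * s < \<bar>q\<bar>" by simp
    have "\<bar>c\<bar> < 1" using c by (simp add: abs_less_iff)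
    \<comment> \<open>The product is the increment of the quadratic with coefficients \<open>4 s\<close> and
      \<open>- 2 \<bar>q\<bar>\<close> from \<open>1\<close> to \<open>\<bar>c\<bar>\<close>.\<close>
    have "0 < (1 - \<bar>c\<bar>) * (2 * \<bar>q\<bar> - 4 * s * (1 + \<bar>c\<bar>))"
    proof (rule mult_pos_pos)
      have "s * \<bar>c\<bar> < s" using s \<open>\<bar>c\<bar> < 1\<close> by simp
      then show "0 < 2 * \<bar>q\<bar> - 4 * s * (1 + \<bar>c\<bar>)" using q4 by (simp add: algebra_simps)
    qed (use \<open>\<bar>c\<bar> < 1\<close> in simp)
    also have "\<dots> \<le> 4 * s * \<bar>c\<bar>\<^sup>2 - 2 * (\<bar>q\<bar> * \<bar>c\<bar>) + p - 2 * s"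
      using ends by (simp add: algebra_simps power2_eq_square del: power2_abs abs_mult_self_eq)
    also have "\<dots> \<le> symbol p q s c"
      using abs_ge_minus_self[of "q * c"] by (simp add: symbol_def abs_mult mult_ac)
    finally show ?thesis .
  qed
qed

lemma region_imp_diff_pos:
  assumes "(p, q, s) \<in> region_D1 \<union> region_D2 \<union> region_D3 \<union> region_D4" "(p, q, s) \<noteq> (0, 0, 0)"
  shows "0 < p - s"
  using assms by (auto simp: region_D1_def region_D2_def region_D3_def region_D4_def)

lemma penta_mat_positive_definite:
  assumes reg: "(p, q, s) \<in> (region_D1 \<union> region_D2 \<union> region_D3 \<union> region_D4) - region_D0"
    and nz: "(p, q, s) \<noteq> (0, 0, 0)" and n: "n \<ge> 1"
  shows "positive_definite (penta_mat p q (p - s) s n)"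
proof -
  have "0 < x" if ev: "eigenvalue (penta_mat p q (p - s) s n) x" for x
  proof (cases "n = 1")
    case True
    \<comment> \<open>A matrix of order one only has the corner entry, so \<open>s\<close> can be traded for \<open>0\<close> if \<open>p\<close> is
      replaced by \<open>p - s\<close>.\<close>
    have "penta_mat p q (p - s) s n = penta_mat (p - s) q (p - s - 0) 0 n"
      using True by (auto simp: penta_mat_def penta_entry_def)
    with ev obtain k where "1 \<le> k" "k \<le> n" and x: "symbol (p - s) q 0 (cos (angle n k)) = x"
      using eigenvalue_penta_mat_iff[of n 0 "p - s" q x] by auto
    then have "angle n k = pi / 2" using True by (simp add: angle_def)
    with x have "x = p - s" by (simp add: symbol_def)
    then show ?thesis using region_imp_diff_pos reg nz by blast
  next
    case False
    with ev obtain k where k: "1 \<le> k" "k \<le> n" and x: "symbol p q s (cos (angle n k)) = x"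
      by (auto simp: eigenvalue_penta_mat_iff)
    have a: "0 < angle n k" "angle n k < pi"
      using k angle_bounds by auto
    have c: "-1 < cos (angle n k)" "cos (angle n k) < 1"
      using cos_monotone_0_pi[of 0 "angle n k"] cos_monotone_0_pi[of "angle n k" pi] a by auto
    have "\<not> (0 < s \<and> p = 2 * s * (1 + 2 * (cos (angle n k))\<^sup>2) \<and> q = - 4 * s * cos (angle n k))"
    proof
      assume "0 < s \<and> p = 2 * s * (1 + 2 * (cos (angle n k))\<^sup>2) \<and> q = - 4 * s * cos (angle n k)"
      then have "(p, q, s) \<in> region_D0"
        unfolding region_D0_def angle_def using k n by blast
      with reg show False by blast
    qed
    then show ?thesis using symbol_pos[OF _ nz c] reg x by blast
  qed
  then show ?thesis
    by (simp add: positive_definite_def transpose_penta_mat) (simp add: penta_mat_def)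
qed

theorem corollary2p1:
  fixes p q r s :: real
  assumes r: "r = p - s"
  shows
    "(\<forall>n::nat. n \<ge> 2 \<or> (n = 1 \<and> s = 0) \<longrightarrow>
       (eigenvalue (penta_mat p q r s n) 0 \<longleftrightarrow>
         (\<exists>k::nat. 1 \<le> k \<and> k \<le> n \<and>
            4 * s * (cos (real k * pi / (real n + 1)))\<^sup>2
              + 2 * q * cos (real k * pi / (real n + 1)) + p - 2 * s = 0))) \<and>
     (\<forall>n::nat. n \<ge> 2 \<or> (n = 1 \<and> s = 0) \<longrightarrow>
       det (penta_mat p q r s n) =
         (\<Prod>k = 1..n. (4 * s * (cos (real k * pi / (real n + 1)))\<^sup>2
            + 2 * q * cos (real k * pi / (real n + 1)) + p - 2 * s))) \<and>
     ((p, q, s) \<in> (region_D1 \<union> region_D2 \<union> region_D3 \<union> region_D4) - region_D0 \<and>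
       (p, q, s) \<noteq> (0, 0, 0) \<longrightarrow>
       (\<forall>n::nat. n \<ge> 1 \<longrightarrow> positive_definite (penta_mat p q r s n)))"
proof -
  have n1: "n \<noteq> 1 \<or> s = 0" if "n \<ge> 2 \<or> (n = 1 \<and> s = 0)" for n :: nat
    using that by auto
  show ?thesis
    unfolding r
    using eigenvalue_penta_mat_iff[OF n1, of _ p q 0, unfolded symbol_def angle_def]
      det_penta_mat[OF n1, of _ p q, unfolded symbol_def angle_def]
      penta_mat_positive_definite[of p q s]
    by (intro conjI allI impI) simp_all
qed

end
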